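(* Let $m\ge 1$ and let $A_1,\dots,A_m$ be a reduced set of patterns over a finite alphabet $\Omega$. The expected waiting time till one of the $m$ patterns is observed is given by $$ E\tau=\frac{\det \mathcal{B}(1)}{\sum_{j=1}^{m}\det \mathcal{B}^j(1)}, $$ where the right-hand side is the limit as $s\to1^-$ of $$ \frac{\det \mathcal{B}(s)}{\sum_{j=1}^{m}\det \mathcal{B}^j(s)+(1-s)\det \mathcal{B}(s)}. $$
   Context: Let $(\xi_n)_{n\ge1}$ be a sequence of i.i.d. random letters from a finite alphabet $\Omega$. For a pattern (word) $A=(a_1,\dots,a_l)\in\Omega^l$, $l\ge 1$, put $Pr(A)=\prod_{k=1}^l Pr(\xi_1=a_k)$; $A_{(k)}=(a_1,\dots,a_k)$ and $A^{(k)}=(a_{l-k+1},\dots,a_l)$ denote the words formed by its first and last $k$ letters, and $Pr(A^{(0)})=1$. For words $U,V$, $[U=V]$ is $1$ if $U=V$ and $0$ otherwise. For patterns $A$, $B$ of lengths $l$, $m'$, the correlation polynomial is $$w_A^B(s)=\sum_{k=1}^{\min\{l,m'\}}[A_{(k)}=B^{(k)}]\,Pr(A^{(l-k)})\,s^{l-k}.$$ A set of $m$ patterns $A_1,\dots,A_m$ of lengths $l_1,\dots,l_m$ is reduced if none of the patterns contains any other as a subpattern (i.e. as a block of consecutive letters). Let $\tau_i$ be the stopping time until $A_i$ occurs, i.e. the least $n\ge l_i$ with $(\xi_{n-l_i+1},\dots,\xi_n)=A_i$, and $\tau=\min\{\tau_i:1\le i\le m\}$. Let $\mathcal{B}(s)=[w_{A_i}^{A_j}(s)]_{1\le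 i,j\le m}$ (row index $i$, column index $j$), and let $\mathcal{B}^j(s)$ be the matrix obtained by replacing the $j$-th column of $\mathcal{B}(s)$ by the column vector $[Pr(A_i)s^{l_i}]_{1\le i\le m}$. *)

theory Defs
  imports "HOL-Probability.Probability" "HOL-Library.Sublist"
begin

definition iid_letters :: "'w measure \<Rightarrow> (nat \<Rightarrow> 'w \<Rightarrow> 'a) \<Rightarrow> bool" where
  "iid_letters M \<xi> \<longleftrightarrow>
     prob_space M \<and>
     prob_space.indep_vars M (\<lambda>_. count_space UNIV) \<xi> {1..} \<and>
     (\<forall>n\<ge>1. distr M (count_space UNIV) (\<xi> n) = distr M (count_space UNIV) (\<xi> 1))"

definition word_prob :: "'w measure \<Rightarrow> (nat \<Rightarrow> 'w \<Rightarrow> 'a) \<Rightarrow> 'a list \<Rightarrow> real" where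
  "word_prob M \<xi> A = (\<Prod>k<length A. measure M {\<omega> \<in> space M. \<xi> 1 \<omega> = A ! k})"

definition last_letters :: "nat \<Rightarrow> 'a list \<Rightarrow> 'a list" where
  "last_letters k A = drop (length A - k) A"

text \<open>The correlation polynomial \<open>w_A^B(s)\<close>, in which \<open>A\<close> contributes its prefixes and
  \<open>B\<close> its suffixes.\<close>

definition corr_poly ::
    "'w measure \<Rightarrow> (nat \<Rightarrow> 'w \<Rightarrow> 'a) \<Rightarrow> 'a list \<Rightarrow> 'a list \<Rightarrow> real \<Rightarrow> real" where
  "corr_poly M \<xi> A B s =
     (\<Sum>k = 1..min (length A) (length B).
        (if take k A = last_letters k B then 1 else 0) *
        word_prob M \<xi> (last_letters (length A - k) A) * s ^ (length A - k))"

definition reduced_patterns :: "('m \<Rightarrow> 'a list) \<Rightarrow> bool" where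
  "reduced_patterns A \<longleftrightarrow> (\<forall>i j. i \<noteq> j \<longrightarrow> \<not> sublist (A i) (A j))"

definition occurs_at :: "(nat \<Rightarrow> 'w \<Rightarrow> 'a) \<Rightarrow> 'a list \<Rightarrow> 'w \<Rightarrow> nat \<Rightarrow> bool" where
  "occurs_at \<xi> A \<omega> n \<longleftrightarrow>
     length A \<le> n \<and> map (\<lambda>k. \<xi> k \<omega>) [n - length A + 1..<n + 1] = A"

text \<open>If the pattern never occurs, the infimum is over the empty set and equals \<open>\<infinity>\<close>.\<close>

definition pattern_time :: "(nat \<Rightarrow> 'w \<Rightarrow> 'a) \<Rightarrow> 'a list \<Rightarrow> 'w \<Rightarrow> enat" where
  "pattern_time \<xi> A \<omega> = (INF n \<in> {n. occurs_at \<xi> A \<omega> n}. enat n)"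

definition waiting_time :: "(nat \<Rightarrow> 'w \<Rightarrow> 'a) \<Rightarrow> ('m::finite \<Rightarrow> 'a list) \<Rightarrow> 'w \<Rightarrow> enat" where
  "waiting_time \<xi> A \<omega> = Min (range (\<lambda>i. pattern_time \<xi> (A i) \<omega>))"

definition expected_waiting_time ::
    "'w measure \<Rightarrow> (nat \<Rightarrow> 'w \<Rightarrow> 'a) \<Rightarrow> ('m::finite \<Rightarrow> 'a list) \<Rightarrow> ennreal" where
  "expected_waiting_time M \<xi> A = (\<integral>\<^sup>+\<omega>. ennreal_of_enat (waiting_time \<xi> A \<omega>) \<partial>M)"

definition corr_matrix ::
    "'w measure \<Rightarrow> (nat \<Rightarrow> 'w \<Rightarrow> 'a) \<Rightarrow> ('m::finite \<Rightarrow> 'a list) \<Rightarrow> real \<Rightarrow> real ^ 'm ^ 'm" where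
  "corr_matrix M \<xi> A s = (\<chi> i j. corr_poly M \<xi> (A i) (A j) s)"

text \<open>Column \<open>j\<close> of the correlation matrix is replaced (in \<open>real ^ 'm ^ 'm\<close> the first index is
  the row).\<close>

definition corr_matrix_repl ::
    "'w measure \<Rightarrow> (nat \<Rightarrow> 'w \<Rightarrow> 'a) \<Rightarrow> ('m::finite \<Rightarrow> 'a list) \<Rightarrow> 'm \<Rightarrow> real \<Rightarrow> real ^ 'm ^ 'm" where
  "corr_matrix_repl M \<xi> A j s =
     (\<chi> i k. if k = j then word_prob M \<xi> (A i) * s ^ length (A i)
             else corr_matrix M \<xi> A s $ i $ k)"

end

theory Submission
  imports Defs
begin

text \<open>
  Write \<open>p a\<close> for the probability of the letter \<open>a\<close>. The waiting time \<open>\<tau>\<close> exceeds \<open>n\<close> exactly when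
  the first \<open>n\<close> letters form a word containing no pattern, so everything about the law of \<open>\<tau>\<close> can
  be expressed by weights of finite words. Let \<open>q n\<close> (\<open>survival n\<close> below) be the total weight
  of the words of length \<open>n\<close> that avoid all patterns, and \<open>h j n\<close> (\<open>hit_weight j n\<close>) the total weight
  of those words of length \<open>n\<close> in which a pattern is first completed at the last letter, this
  pattern being \<open>A j\<close>. Because no pattern contains another one, \<open>j\<close> is determined by the word.

  Append a whole pattern \<open>A i\<close> to an avoiding word \<open>w\<close> of length \<open>n\<close>. Some pattern is first
  completed after a number \<open>k\<close> of the appended letters with \<open>1 \<le> k \<le> length (A i)\<close>; if it is \<open>A j\<close>,
  reducedness forces \<open>k \<le> length (A j)\<close>, so the first \<open>k\<close> letters of \<open>A i\<close> are the last \<open>k\<close> letters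
  of \<open>A j\<close>. Conversely every word first ended by \<open>A j\<close>, together with such an overlap \<open>k\<close>, arises
  from precisely one \<open>w\<close>. Hence (\<open>survival_times_pattern\<close>)

    \<open>q n * Pr (A i) = (\<Sum>j. \<Sum>k. Pr (A i without its first k letters) * h j (n + k))\<close>,

  where \<open>k\<close> runs over these overlaps. With \<open>Q\<close> and \<open>H j\<close> the generating functions of \<open>q\<close> and \<open>h j\<close>,
  and \<open>b\<close> the column with entries \<open>Pr (A i) * s ^ length (A i)\<close>, this says \<open>B H = Q b\<close>
  for \<open>0 \<le> s < 1\<close> (\<open>correlation_hit_gf\<close>). Appending a single letter instead gives
  \<open>q n = q (n + 1) + (\<Sum>j. h j (n + 1))\<close>, that is, \<open>(\<Sum>j. H j) = 1 - (1 - s) Q\<close>. Cramer's rule turns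
  the first identity into \<open>Q det (B\<^sup>j) = H j det B\<close>; summing over \<open>j\<close> and using the second gives

    \<open>det B = Q * ((\<Sum>j. det (B\<^sup>j)) + (1 - s) det B)\<close>.

  So the quotient in question is \<open>Q s\<close> wherever \<open>det B \<noteq> 0\<close>. This holds near \<open>1\<close>: the function \<open>det B\<close>
  is a polynomial in \<open>s\<close> and is not the zero polynomial, since \<open>B 0\<close> is the identity matrix.
  Finally \<open>Q s\<close> increases to \<open>(\<Sum>n. q n) = (\<Sum>n. Pr (\<tau> > n)) = E \<tau>\<close> as \<open>s\<close> tends to \<open>1\<close> from the left.
  Both the limit and \<open>E \<tau>\<close> are infinite when the series diverges.
\<close>

section \<open>Words avoiding the patterns and words ending at a first occurrence\<close>

definition word_weight :: "('a \<Rightarrow> real) \<Rightarrow> 'a list \<Rightarrow> real" where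
  "word_weight p w = prod_list (map p w)"

lemma word_weight_append: "word_weight p (u @ v) = word_weight p u * word_weight p v"
  by (simp add: word_weight_def)

lemma word_weight_nonneg: "(\<And>a. 0 \<le> p a) \<Longrightarrow> 0 \<le> word_weight p w"
  unfolding word_weight_def by (induction w) auto

locale weighted_patterns =
  fixes p :: "'a::finite \<Rightarrow> real" and A :: "'m::finite \<Rightarrow> 'a list"
  assumes p_nonneg: "0 \<le> p a"
    and p_sum: "(\<Sum>a\<in>UNIV. p a) = 1"
    and nonempty: "A i \<noteq> []"
    and reduced: "i \<noteq> j \<Longrightarrow> \<not> sublist (A i) (A j)"
begin

definition avoiding :: "nat \<Rightarrow> 'a list set" where
  "avoiding n = {w. length w = n \<and> (\<forall>i. \<not> sublist (A i) w)}"

definition first_ending :: "'m \<Rightarrow> nat \<Rightarrow> 'a list set" where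
  "first_ending j n = {w. length w = n \<and> suffix (A j) w \<and> (\<forall>i. \<not> sublist (A i) (butlast w))}"

text \<open>
  The lengths \<open>k\<close> of the overlaps that contribute a term to the correlation polynomial of \<open>A i\<close>
  and \<open>A j\<close>.
\<close>

definition overlaps :: "'m \<Rightarrow> 'm \<Rightarrow> nat set" where
  "overlaps i j = {k \<in> {1..min (length (A i)) (length (A j))}. take k (A i) = last_letters k (A j)}"

lemma finite_avoiding: "finite (avoiding n)"
  by (rule finite_subset[OF _ finite_lists_length_eq[of UNIV n]]) (auto simp: avoiding_def)

lemma finite_first_ending: "finite (first_ending j n)"
  by (rule finite_subset[OF _ finite_lists_length_eq[of UNIV n]]) (auto simp: first_ending_def)

lemma finite_overlaps: "finite (overlaps i j)"
  by (simp add: overlaps_def)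

text \<open>
  If \<open>v\<close> were a proper prefix of \<open>v'\<close>, then \<open>v'\<close> would contain a pattern before its last letter. Once
  the words agree, of the two patterns ending them the shorter is a suffix of the longer one,
  which reducedness permits only if they have the same index.
\<close>

lemma first_ending_prefix_unique:
  assumes v: "v \<in> first_ending j m" and v': "v' \<in> first_ending j' m'" and pre: "prefix v v'"
  shows "v = v' \<and> j = j'"
proof -
  have eq: "v = v'"
  proof (rule ccontr)
    assume "v \<noteq> v'"
    with pre have "prefix v (butlast v')"
      by (metis append_butlast_last_id butlast.simps(1) prefix_snoc)
    moreover have "suffix (A j) v" using v by (simp add: first_ending_def)
    ultimately have "sublist (A j) (butlast v')"
      by (meson prefix_imp_sublist sublist_order.order.trans suffix_imp_sublist)
    with v' show False by (simp add: first_ending_def)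
  qed
  have "suffix (A j) v" "suffix (A j') v" using v v' eq by (auto simp: first_ending_def)
  then have "sublist (A j) (A j') \<or> sublist (A j') (A j)"
    using suffix_same_cases by blast
  with reduced have "j = j'" by metis
  with eq show ?thesis by simp
qed

lemma first_ending_split:
  assumes k: "k \<in> overlaps i j" and v: "v \<in> first_ending j (n + k)"
  shows "v = take n v @ take k (A i)"
proof -
  have "suffix (take k (A i)) (A j)"
    using k by (simp add: overlaps_def last_letters_def suffix_drop)
  then have "suffix (take k (A i)) v"
    using v suffix_order.trans by (auto simp: first_ending_def)
  then obtain u where u: "v = u @ take k (A i)" by (auto simp: suffix_def)
  have "length v = n + k" using v by (simp add: first_ending_def)
  moreover have "length (take k (A i)) = k" using k by (simp only: overlaps_def length_take) simp
  ultimately have "length u = n" using u by simp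
  with u show ?thesis by simp
qed

lemma take_first_ending_avoiding:
  assumes k: "k \<in> overlaps i j" and v: "v \<in> first_ending j (n + k)"
  shows "take n v \<in> avoiding n"
proof -
  have "1 \<le> k" using k by (simp add: overlaps_def)
  moreover have len: "length v = n + k" using v by (simp add: first_ending_def)
  ultimately have "take n v = take n (butlast v)"
    by (simp add: butlast_conv_take min_def)
  then have "prefix (take n v) (butlast v)" by (metis take_is_prefix)
  then show ?thesis
    using v len unfolding avoiding_def first_ending_def
    by (auto dest: prefix_imp_sublist sublist_order.order.trans)
qed

lemma sublist_snoc_new:
  "sublist x (u @ [c]) \<Longrightarrow> \<not> sublist x u \<Longrightarrow> suffix x (u @ [c])"
  by (metis sublist_snoc)

text \<open>
  Existence half of the bijection: while \<open>A i\<close> is appended to \<open>w\<close> letter by letter, some pattern is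
  completed for the first time, at the latest when \<open>A i\<close> itself is.
\<close>

lemma extension_first_ending:
  assumes w: "w \<in> avoiding n"
  obtains j k where "k \<in> overlaps i j" and "w @ take k (A i) \<in> first_ending j (n + k)"
proof -
  define hit where "hit k \<longleftrightarrow> (\<exists>j. sublist (A j) (w @ take k (A i)))" for k
  define k where "k = (LEAST k. hit k)"
  have hl: "hit (length (A i))" unfolding hit_def by (rule exI[of _ i]) simp
  have hk: "hit k" unfolding k_def by (rule LeastI[of hit, OF hl])
  have kl: "k \<le> length (A i)" unfolding k_def by (rule Least_le[of hit, OF hl])
  have "\<not> hit 0" using w by (simp add: hit_def avoiding_def)
  with hk obtain k' where k': "k = Suc k'" by (cases k) auto
  have nh: "\<not> hit k'" using not_less_Least[of k' hit] k' by (simp add: k_def[symmetric])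
  obtain j where j: "sublist (A j) (w @ take k (A i))" using hk by (auto simp: hit_def)
  have snoc: "w @ take k (A i) = (w @ take k' (A i)) @ [A i ! k']"
    using kl k' by (simp add: take_Suc_conv_app_nth)
  have suf: "suffix (A j) (w @ take k (A i))"
    using j nh unfolding snoc hit_def by (intro sublist_snoc_new) auto
  have lw: "length w = n" using w by (simp add: avoiding_def)
  have fe: "w @ take k (A i) \<in> first_ending j (n + k)"
  proof -
    have "butlast (w @ take k (A i)) = w @ take k' (A i)" unfolding snoc by (rule butlast_snoc)
    then show ?thesis using suf nh lw kl by (simp add: first_ending_def hit_def)
  qed
  \<comment> \<open>A pattern with fewer than \<open>k\<close> letters would lie inside the appended part of \<open>A i\<close>.\<close>
  have kj: "k \<le> length (A j)"
  proof (rule ccontr)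
    assume "\<not> k \<le> length (A j)"
    then have less: "length (A j) < k" by simp
    then have "suffix (A j) (take k (A i))"
      using suf kl by (intro suffix_length_suffix[OF suf]) (auto simp: suffix_def)
    then have "sublist (A j) (A i)"
      by (meson sublist_order.order.trans sublist_take suffix_imp_sublist)
    moreover have "j \<noteq> i" using less kl by auto
    ultimately show False using reduced by blast
  qed
  have "suffix (take k (A i)) (A j)"
    using kj kl by (intro suffix_length_suffix[OF _ suf]) (auto simp: suffix_def)
  then have "take k (A i) = last_letters k (A j)"
    using kl by (auto simp: suffix_def last_letters_def)
  then have "k \<in> overlaps i j"
    using kj kl k' by (simp add: overlaps_def)
  with fe show ?thesis using that by blast
qed

text \<open>
  The triple \<open>(j, k, v)\<close> is recovered from \<open>w = take n v\<close>: by \<open>first_ending_split\<close>, \<open>v\<close> is a prefix of \<open>w @ A i\<close>,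
  and by \<open>first_ending_prefix_unique\<close> at most one such prefix ends at a first occurrence.
\<close>

lemma first_ending_bij_avoiding:
  "bij_betw (\<lambda>(j, k, v). take n v)
     (SIGMA j:UNIV. SIGMA k:overlaps i j. first_ending j (n + k)) (avoiding n)"
proof (rule bij_betw_imageI)
  show "inj_on (\<lambda>(j, k, v). take n v) (SIGMA j:UNIV. SIGMA k:overlaps i j. first_ending j (n + k))"
  proof (rule inj_onI, clarsimp)
    fix j k v j' k' v'
    assume k: "k \<in> overlaps i j" "v \<in> first_ending j (n + k)"
      and k': "k' \<in> overlaps i j'" "v' \<in> first_ending j' (n + k')"
      and eq: "take n v = take n v'"
    have "v = take n v @ take k (A i)" "v' = take n v @ take k' (A i)"
      using first_ending_split[OF k] first_ending_split[OF k'] eq by auto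
    then have "prefix v (take n v @ A i)" "prefix v' (take n v @ A i)"
      by (metis same_prefix_prefix take_is_prefix)+
    then have "prefix v v' \<or> prefix v' v" using prefix_same_cases by blast
    then have vj: "v = v' \<and> j = j'"
      using first_ending_prefix_unique k(2) k'(2) by metis
    moreover have "n + k = n + k'"
      using k(2) k'(2) vj by (simp add: first_ending_def)
    ultimately show "j = j' \<and> k = k' \<and> v = v'" by simp
  qed
  show "(\<lambda>(j, k, v). take n v) ` (SIGMA j:UNIV. SIGMA k:overlaps i j. first_ending j (n + k)) = avoiding n"
  proof (intro equalityI subsetI)
    fix w assume "w \<in> (\<lambda>(j, k, v). take n v) ` (SIGMA j:UNIV. SIGMA k:overlaps i j. first_ending j (n + k))"
    then show "w \<in> avoiding n" by (auto intro: take_first_ending_avoiding)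
  next
    fix w assume w: "w \<in> avoiding n"
    then obtain j k where jk: "k \<in> overlaps i j" "w @ take k (A i) \<in> first_ending j (n + k)"
      by (rule extension_first_ending)
    moreover have "take n (w @ take k (A i)) = w" using w by (simp add: avoiding_def)
    ultimately show "w \<in> (\<lambda>(j, k, v). take n v) ` (SIGMA j:UNIV. SIGMA k:overlaps i j. first_ending j (n + k))"
      by (intro image_eqI[of _ _ "(j, k, w @ take k (A i))"]) auto
  qed
qed

definition survival :: "nat \<Rightarrow> real" where
  "survival n = (\<Sum>w\<in>avoiding n. word_weight p w)"

definition hit_weight :: "'m \<Rightarrow> nat \<Rightarrow> real" where
  "hit_weight j n = (\<Sum>w\<in>first_ending j n. word_weight p w)"

text \<open>
  The weight of a word is multiplicative, so \<open>w @ A i\<close> and the same word cut as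
  \<open>v @ drop k (A i)\<close> give the two sides.
\<close>

lemma survival_times_pattern:
  "survival n * word_weight p (A i) =
     (\<Sum>j\<in>UNIV. \<Sum>k\<in>overlaps i j. word_weight p (drop k (A i)) * hit_weight j (n + k))"
proof -
  have "survival n * word_weight p (A i) = (\<Sum>w\<in>avoiding n. word_weight p w * word_weight p (A i))"
    by (simp add: survival_def sum_distrib_right)
  also have "\<dots> = (\<Sum>(j, k, v)\<in>(SIGMA j:UNIV. SIGMA k:overlaps i j. first_ending j (n + k)).
      word_weight p (take n v) * word_weight p (A i))"
    by (subst sum.reindex_bij_betw[OF first_ending_bij_avoiding, of _ n i, symmetric])
      (simp add: case_prod_unfold)
  also have "\<dots> = (\<Sum>(j, k, v)\<in>(SIGMA j:UNIV. SIGMA k:overlaps i j. first_ending j (n + k)).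
      word_weight p (drop k (A i)) * word_weight p v)"
  proof (rule sum.cong[OF refl], clarsimp)
    fix j k v assume kv: "k \<in> overlaps i j" "v \<in> first_ending j (n + k)"
    have "word_weight p v = word_weight p (take n v) * word_weight p (take k (A i))"
      by (metis first_ending_split[OF kv] word_weight_append)
    moreover have "word_weight p (A i) = word_weight p (take k (A i)) * word_weight p (drop k (A i))"
      by (metis append_take_drop_id word_weight_append)
    ultimately show "word_weight p (take n v) * word_weight p (A i) = word_weight p (drop k (A i)) * word_weight p v"
      by simp
  qed
  also have "\<dots> = (\<Sum>j\<in>UNIV. \<Sum>k\<in>overlaps i j. \<Sum>v\<in>first_ending j (n + k).
      word_weight p (drop k (A i)) * word_weight p v)"
    by (simp add: sum.Sigma[symmetric] finite_overlaps finite_first_ending finite_SigmaI)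
  finally show ?thesis by (simp add: hit_weight_def sum_distrib_left)
qed

lemma survival_nonneg: "0 \<le> survival n"
  unfolding survival_def by (intro sum_nonneg word_weight_nonneg p_nonneg)

lemma hit_weight_nonneg: "0 \<le> hit_weight j n"
  unfolding hit_weight_def by (intro sum_nonneg word_weight_nonneg p_nonneg)

lemma survival_0: "survival 0 = 1"
proof -
  have "avoiding 0 = {[]}" using nonempty by (auto simp: avoiding_def)
  then show ?thesis by (simp add: survival_def word_weight_def)
qed

lemma hit_weight_short: "n < length (A j) \<Longrightarrow> hit_weight j n = 0"
  unfolding hit_weight_def
  by (rule sum.neutral) (auto simp: first_ending_def dest: suffix_length_le)

text \<open>
  A one-letter extension of an avoiding word either avoids the patterns again or ends at a
  first occurrence; the weights of the letters sum to \<open>1\<close>.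
\<close>

lemma survival_Suc: "survival n = survival (Suc n) + (\<Sum>j\<in>UNIV. hit_weight j (Suc n))"
proof -
  let ?E = "(\<lambda>(w, c). w @ [c]) ` (avoiding n \<times> UNIV)"
  have inj: "inj_on (\<lambda>(w, c). w @ [c]) (avoiding n \<times> UNIV)" by (auto simp: inj_on_def)
  have "survival n = (\<Sum>w\<in>avoiding n. \<Sum>c\<in>UNIV. word_weight p w * p c)"
    by (simp add: survival_def sum_distrib_left[symmetric] p_sum)
  also have "\<dots> = (\<Sum>(w, c)\<in>avoiding n \<times> UNIV. word_weight p w * p c)"
    by (rule sum.cartesian_product)
  also have "\<dots> = sum (word_weight p) ?E"
    by (subst sum.reindex[OF inj]) (auto simp: word_weight_def case_prod_unfold)
  also have "?E = avoiding (Suc n) \<union> (\<Union>j. first_ending j (Suc n))"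
  proof (intro equalityI subsetI)
    fix v assume "v \<in> ?E"
    then obtain w c where "v = w @ [c]" "w \<in> avoiding n" by auto
    then show "v \<in> avoiding (Suc n) \<union> (\<Union>j. first_ending j (Suc n))"
      using sublist_snoc_new[of _ w c] by (auto simp: avoiding_def first_ending_def simp del: suffix_snoc)
  next
    fix v assume v: "v \<in> avoiding (Suc n) \<union> (\<Union>j. first_ending j (Suc n))"
    then have "length v = Suc n" by (auto simp: avoiding_def first_ending_def)
    then obtain w c where vw: "v = w @ [c]" "length w = n"
      by (metis length_Suc_conv_rev)
    have "w \<in> avoiding n"
      using v vw by (auto simp: avoiding_def first_ending_def sublist_snoc)
    with vw show "v \<in> ?E" by auto
  qed
  also have "sum (word_weight p) \<dots> =
      survival (Suc n) + sum (word_weight p) (\<Union>j. first_ending j (Suc n))"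
    unfolding survival_def
  proof (rule sum.union_disjoint)
    show "avoiding (Suc n) \<inter> (\<Union>j. first_ending j (Suc n)) = {}"
      by (auto simp: avoiding_def first_ending_def)
  qed (auto simp: finite_avoiding finite_first_ending)
  also have "sum (word_weight p) (\<Union>j. first_ending j (Suc n)) = (\<Sum>j\<in>UNIV. hit_weight j (Suc n))"
    unfolding hit_weight_def
  proof (rule sum.UNION_disjoint)
    have "v \<in> first_ending j (Suc n) \<Longrightarrow> v \<in> first_ending j' (Suc n) \<Longrightarrow> j = j'" for v j j'
      using first_ending_prefix_unique[of v j "Suc n" v j' "Suc n"] by simp
    then show "\<forall>j\<in>UNIV. \<forall>j'\<in>UNIV. j \<noteq> j' \<longrightarrow> first_ending j (Suc n) \<inter> first_ending j' (Suc n) = {}"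
      by (meson disjoint_iff)
  qed (simp_all add: finite_first_ending)
  finally show ?thesis .
qed

lemma survival_le_1: "survival n \<le> 1"
proof (induction n)
  case (Suc n)
  have "0 \<le> (\<Sum>j\<in>UNIV. hit_weight j (Suc n))" by (intro sum_nonneg hit_weight_nonneg)
  with Suc survival_Suc[of n] show ?case by linarith
qed (simp add: survival_0)

lemma hit_weight_le_1: "hit_weight j n \<le> 1"
proof (cases n)
  case 0
  then show ?thesis using hit_weight_short[of 0 j] nonempty[of j] by simp
next
  case (Suc m)
  have "hit_weight j n \<le> (\<Sum>j\<in>UNIV. hit_weight j n)"
    by (rule member_le_sum) (auto simp: hit_weight_nonneg)
  also have "\<dots> \<le> 1"
    unfolding Suc using survival_Suc[of m] survival_le_1[of m] survival_nonneg[of "Suc m"] by linarith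
  finally show ?thesis .
qed

end

section \<open>Determinants with polynomial entries and power series at \<open>1\<close>\<close>

lemma det_poly:
  fixes P :: "'n::finite \<Rightarrow> 'n \<Rightarrow> real poly"
  shows "det (\<chi> i j. poly (P i j) s) = poly (det (\<chi> i j. P i j)) s"
  by (simp add: det_def poly_sum poly_prod)

lemma eventually_poly_nonzero:
  fixes q :: "real poly"
  assumes "q \<noteq> 0"
  shows "eventually (\<lambda>s. poly q s \<noteq> 0) (at x within S)"
proof -
  have "\<not> x islimpt {s. poly q s = 0}"
    using poly_roots_finite[OF assms] islimpt_finite by blast
  then have "eventually (\<lambda>s. poly q s \<noteq> 0) (at x)"
    by (simp add: islimpt_iff_eventually)
  then show ?thesis
    using at_le[of S UNIV x] by (auto simp: filter_leD)
qed

lemma eventually_at_left_1_unit: "eventually (\<lambda>s::real. 0 < s \<and> s < 1) (at_left 1)"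
  by (rule eventually_at_leftI[of 0]) auto

lemma summable_bounded_power:
  fixes a :: "nat \<Rightarrow> real"
  assumes "\<And>n. 0 \<le> a n" "\<And>n. a n \<le> 1" "0 \<le> s" "s < 1"
  shows "summable (\<lambda>n. a n * s ^ n)"
proof (rule summable_comparison_test_ev)
  show "summable (\<lambda>n. s ^ n)" using assms by (intro summable_geometric) auto
  show "\<forall>\<^sub>F n in sequentially. norm (a n * s ^ n) \<le> s ^ n"
    using assms by (auto simp: abs_mult intro!: mult_right_le_one_le always_eventually mult_left_le_one_le)
qed

text \<open>
  The limit may be infinite, so Abel's theorem does not suffice; since the coefficients are
  nonnegative, the series lies between its partial sums, which are continuous at \<open>1\<close>, and its
  value at \<open>1\<close>.
\<close>

lemma tendsto_power_series_at_left_1: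
  fixes a :: "nat \<Rightarrow> real"
  assumes nonneg: "\<And>n. 0 \<le> a n"
    and summable: "\<And>s. 0 < s \<Longrightarrow> s < 1 \<Longrightarrow> summable (\<lambda>n. a n * s ^ n)"
  shows "((\<lambda>s. ereal (\<Sum>n. a n * s ^ n)) \<longlongrightarrow> enn2ereal (\<Sum>n. ennreal (a n))) (at_left 1)"
proof -
  have lim: "((\<lambda>s. \<Sum>n. ennreal (a n * s ^ n)) \<longlongrightarrow> (\<Sum>n. ennreal (a n))) (at_left 1)"
  proof (rule order_tendstoI)
    fix c assume "c < (\<Sum>n. ennreal (a n))"
    then obtain N where N: "c < (\<Sum>n<N. ennreal (a n))"
      by (auto simp: suminf_eq_SUP less_SUP_iff)
    have "((\<lambda>s. \<Sum>n<N. ennreal (a n * s ^ n)) \<longlongrightarrow> (\<Sum>n<N. ennreal (a n * 1 ^ n))) (at_left 1)"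
      by (intro tendsto_sum tendsto_ennrealI tendsto_intros)
    then have "\<forall>\<^sub>F s in at_left 1. c < (\<Sum>n<N. ennreal (a n * s ^ n))"
      using N by (intro order_tendstoD(1)) auto
    then show "\<forall>\<^sub>F s in at_left 1. c < (\<Sum>n. ennreal (a n * s ^ n))"
      by eventually_elim (rule less_le_trans, assumption, rule sum_le_suminf, auto)
  next
    fix c assume c: "(\<Sum>n. ennreal (a n)) < c"
    show "\<forall>\<^sub>F s in at_left 1. (\<Sum>n. ennreal (a n * s ^ n)) < c"
      using eventually_at_left_1_unit
    proof eventually_elim
      case (elim s)
      have "(\<Sum>n. ennreal (a n * s ^ n)) \<le> (\<Sum>n. ennreal (a n))"
        using elim nonneg
        by (intro suminf_le ennreal_leI) (auto intro!: mult_left_le power_le_one)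
      with c show ?case by simp
    qed
  qed
  have "\<forall>\<^sub>F s in at_left 1. enn2ereal (\<Sum>n. ennreal (a n * s ^ n)) = ereal (\<Sum>n. a n * s ^ n)"
    using eventually_at_left_1_unit
  proof eventually_elim
    case (elim s)
    have pos: "0 \<le> a n * s ^ n" for n using elim nonneg by simp
    have "(\<Sum>n. ennreal (a n * s ^ n)) = ennreal (\<Sum>n. a n * s ^ n)"
      using elim by (intro suminf_ennreal_eq pos summable_sums summable) auto
    moreover have "0 \<le> (\<Sum>n. a n * s ^ n)"
      using elim by (intro suminf_nonneg pos summable) auto
    ultimately show ?case by (simp add: enn2ereal_ennreal)
  qed
  with tendsto_enn2erealI[OF lim] show ?thesis
    by (rule Lim_transform_eventually)
qed

section \<open>Generating functions and Cramer's rule\<close>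

context weighted_patterns
begin

definition correlation :: "real \<Rightarrow> real ^ 'm ^ 'm" where
  "correlation s = (\<chi> i j. \<Sum>k\<in>overlaps i j. word_weight p (drop k (A i)) * s ^ (length (A i) - k))"

definition pattern_weights :: "real \<Rightarrow> real ^ 'm" where
  "pattern_weights s = (\<chi> i. word_weight p (A i) * s ^ length (A i))"

definition correlation_repl :: "'m \<Rightarrow> real \<Rightarrow> real ^ 'm ^ 'm" where
  "correlation_repl j s =
     (\<chi> i k. if k = j then pattern_weights s $ i else correlation s $ i $ k)"

definition survival_gf :: "real \<Rightarrow> real" where
  "survival_gf s = (\<Sum>n. survival n * s ^ n)"

definition hit_gf :: "real \<Rightarrow> real ^ 'm" where
  "hit_gf s = (\<chi> j. \<Sum>n. hit_weight j n * s ^ n)"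

lemma survival_gf_sums:
  "0 \<le> s \<Longrightarrow> s < 1 \<Longrightarrow> (\<lambda>n. survival n * s ^ n) sums survival_gf s"
  unfolding survival_gf_def
  by (intro summable_sums summable_bounded_power survival_nonneg survival_le_1)

lemma hit_gf_sums:
  "0 \<le> s \<Longrightarrow> s < 1 \<Longrightarrow> (\<lambda>n. hit_weight j n * s ^ n) sums (hit_gf s $ j)"
  unfolding hit_gf_def vec_lambda_beta
  by (intro summable_sums summable_bounded_power hit_weight_nonneg hit_weight_le_1)

lemma survival_gf_pos:
  assumes "0 \<le> s" "s < 1"
  shows "0 < survival_gf s"
proof -
  have "(\<Sum>n<1. survival n * s ^ n) \<le> survival_gf s"
    unfolding survival_gf_def
    using assms by (intro sum_le_suminf sums_summable[OF survival_gf_sums]) (auto simp: survival_nonneg)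
  then show ?thesis by (simp add: survival_0)
qed

text \<open>
  The identity \<open>survival_Suc\<close>, multiplied by \<open>s ^ (n + 1)\<close> and summed over \<open>n\<close>.
\<close>

lemma sum_hit_gf:
  assumes s: "0 \<le> s" "s < 1"
  shows "(\<Sum>j\<in>UNIV. hit_gf s $ j) = 1 - (1 - s) * survival_gf s"
proof -
  have Q: "(\<lambda>n. survival n * s ^ n) sums survival_gf s"
    by (rule survival_gf_sums[OF s])
  have "(\<lambda>n. survival (Suc n) * s ^ Suc n) sums (survival_gf s - survival 0 * s ^ 0)"
    using sums_Suc_iff[of "\<lambda>n. survival n * s ^ n" "survival_gf s - survival 0 * s ^ 0"] Q
    by simp
  moreover have "(\<lambda>n. s * (survival n * s ^ n)) sums (s * survival_gf s)"
    by (rule sums_mult[OF Q])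
  ultimately have "(\<lambda>n. s * (survival n * s ^ n) - survival (Suc n) * s ^ Suc n) sums
      (s * survival_gf s - (survival_gf s - survival 0 * s ^ 0))"
    by (intro sums_diff)
  also have "(\<lambda>n. s * (survival n * s ^ n) - survival (Suc n) * s ^ Suc n) =
      (\<lambda>n. \<Sum>j\<in>UNIV. hit_weight j (Suc n) * s ^ Suc n)"
  proof
    fix n
    have "(\<Sum>j\<in>UNIV. hit_weight j (Suc n) * s ^ Suc n) = (survival n - survival (Suc n)) * s ^ Suc n"
      by (simp only: sum_distrib_right[symmetric] survival_Suc[of n] add_diff_cancel_left')
    then show "s * (survival n * s ^ n) - survival (Suc n) * s ^ Suc n =
        (\<Sum>j\<in>UNIV. hit_weight j (Suc n) * s ^ Suc n)"
      by (simp add: algebra_simps)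
  qed
  finally have 1: "(\<lambda>n. \<Sum>j\<in>UNIV. hit_weight j (Suc n) * s ^ Suc n) sums (1 - (1 - s) * survival_gf s)"
    by (simp add: survival_0 algebra_simps)
  have "(\<lambda>n. hit_weight j (Suc n) * s ^ Suc n) sums (hit_gf s $ j)" for j
    using sums_Suc_iff[of "\<lambda>n. hit_weight j n * s ^ n" "hit_gf s $ j"] hit_gf_sums[OF s, of j]
      hit_weight_short[of 0 j] nonempty[of j] by simp
  then have "(\<lambda>n. \<Sum>j\<in>UNIV. hit_weight j (Suc n) * s ^ Suc n) sums (\<Sum>j\<in>UNIV. hit_gf s $ j)"
    by (intro sums_sum)
  from sums_unique2[OF this 1] show ?thesis .
qed

text \<open>
  The identity \<open>survival_times_pattern\<close>, multiplied by \<open>s ^ (n + length (A i))\<close> and summed over \<open>n\<close>. The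
  index of \<open>hit_weight j\<close> starts at \<open>k\<close> instead of \<open>0\<close>; nothing is lost, because \<open>A j\<close> cannot occur
  before time \<open>length (A j) \<ge> k\<close>.
\<close>

lemma correlation_hit_gf:
  assumes s: "0 \<le> s" "s < 1"
  shows "correlation s *v hit_gf s = survival_gf s *s pattern_weights s"
proof (rule vec_eq_iff[THEN iffD2], rule allI)
  fix i
  have shift: "(\<lambda>n. hit_weight j (n + k) * s ^ (n + k)) sums (hit_gf s $ j)"
    if "k \<in> overlaps i j" for j k
    using sums_zero_iff_shift[of k "\<lambda>n. hit_weight j n * s ^ n" "hit_gf s $ j"] that
      hit_gf_sums[OF s, of j] hit_weight_short[of _ j] by (simp add: overlaps_def)
  have "(\<lambda>n. \<Sum>j\<in>UNIV. \<Sum>k\<in>overlaps i j.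
        word_weight p (drop k (A i)) * s ^ (length (A i) - k) * (hit_weight j (n + k) * s ^ (n + k)))
      sums (\<Sum>j\<in>UNIV. \<Sum>k\<in>overlaps i j.
        word_weight p (drop k (A i)) * s ^ (length (A i) - k) * hit_gf s $ j)"
    by (intro sums_sum sums_mult shift)
  moreover have "(\<Sum>j\<in>UNIV. \<Sum>k\<in>overlaps i j.
        word_weight p (drop k (A i)) * s ^ (length (A i) - k) * (hit_weight j (n + k) * s ^ (n + k)))
      = survival n * s ^ n * (word_weight p (A i) * s ^ length (A i))" (is "?L = ?R") for n
  proof -
    have pow: "s ^ (length (A i) - k) * s ^ (n + k) = s ^ (n + length (A i))"
      if "k \<in> overlaps i j" for j k
      using that by (simp add: overlaps_def power_add[symmetric] add.commute)
    have "?L = (\<Sum>j\<in>UNIV. \<Sum>k\<in>overlaps i j.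
        word_weight p (drop k (A i)) * hit_weight j (n + k) * s ^ (n + length (A i)))"
      by (intro sum.cong refl) (simp add: pow[symmetric] mult_ac)
    also have "\<dots> = survival n * word_weight p (A i) * s ^ (n + length (A i))"
      by (simp add: survival_times_pattern sum_distrib_right)
    finally show ?thesis by (simp add: power_add mult_ac)
  qed
  ultimately have "(\<lambda>n. survival n * s ^ n * (word_weight p (A i) * s ^ length (A i)))
      sums (\<Sum>j\<in>UNIV. correlation s $ i $ j * hit_gf s $ j)"
    by (simp add: correlation_def sum_distrib_right)
  then have "(\<Sum>j\<in>UNIV. correlation s $ i $ j * hit_gf s $ j)
      = survival_gf s * (word_weight p (A i) * s ^ length (A i))"
    using sums_unique2 sums_mult2[OF survival_gf_sums[OF s]] by blast
  then show "(correlation s *v hit_gf s) $ i = (survival_gf s *s pattern_weights s) $ i"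
    by (simp add: matrix_vector_mult_def pattern_weights_def)
qed

text \<open>
  Cramer's rule for the solution \<open>hit_gf s / survival_gf s\<close> of the linear system with right-hand
  side \<open>pattern_weights s\<close>. Division by \<open>survival_gf s\<close> is possible because it is positive.
\<close>

lemma det_correlation_repl:
  assumes s: "0 \<le> s" "s < 1"
  shows "survival_gf s * det (correlation_repl j s) = hit_gf s $ j * det (correlation s)"
proof -
  define x where "x = inverse (survival_gf s) *s hit_gf s"
  have Q: "survival_gf s \<noteq> 0" using survival_gf_pos[OF s] by simp
  have "correlation s *v x = pattern_weights s"
    using Q by (simp add: x_def vector_scalar_commute correlation_hit_gf[OF s] vector_smult_assoc)
  then have "correlation_repl j s =
      (\<chi> i k. if k = j then (correlation s *v x) $ i else correlation s $ i $ k)"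
    by (simp only: correlation_repl_def)
  then have "det (correlation_repl j s) = x $ j * det (correlation s)"
    by (simp only: cramer_lemma)
  then show ?thesis using Q by (simp add: x_def)
qed

lemma det_correlation_eq:
  assumes s: "0 \<le> s" "s < 1"
  shows "det (correlation s) =
    survival_gf s * ((\<Sum>j\<in>UNIV. det (correlation_repl j s)) + (1 - s) * det (correlation s))"
proof -
  have "survival_gf s * (\<Sum>j\<in>UNIV. det (correlation_repl j s))
      = (\<Sum>j\<in>UNIV. hit_gf s $ j) * det (correlation s)"
    by (simp add: sum_distrib_left sum_distrib_right det_correlation_repl[OF s])
  then show ?thesis by (simp add: sum_hit_gf[OF s] algebra_simps)
qed

text \<open>
  An overlap of full length makes \<open>A i\<close> a suffix of \<open>A j\<close>. At \<open>s = 0\<close> only the summands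
  with \<open>k = length (A i)\<close> survive, so this computes the correlation matrix there.
\<close>

lemma full_overlap_iff: "length (A i) \<in> overlaps i j \<longleftrightarrow> i = j"
proof
  assume k: "length (A i) \<in> overlaps i j"
  then have "A i = last_letters (length (A i)) (A j)" by (simp add: overlaps_def)
  then have "sublist (A i) (A j)" by (metis last_letters_def sublist_drop)
  with reduced show "i = j" by blast
next
  assume "i = j"
  then show "length (A i) \<in> overlaps i j"
    using nonempty[of i] by (simp add: overlaps_def last_letters_def Suc_le_eq)
qed

lemma correlation_0: "correlation 0 = mat 1"
proof -
  have "correlation 0 $ i $ j = (if i = j then 1 else 0)" for i j
  proof -
    have "(\<Sum>k\<in>overlaps i j. word_weight p (drop k (A i)) * 0 ^ (length (A i) - k))
        = (\<Sum>k\<in>overlaps i j. if k = length (A i) then 1 else 0)"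
      by (intro sum.cong refl) (auto simp: overlaps_def word_weight_def)
    also have "\<dots> = (if i = j then 1 else 0)"
      using full_overlap_iff by (simp add: finite_overlaps)
    finally show ?thesis by (simp add: correlation_def)
  qed
  then show ?thesis by (simp add: vec_eq_iff mat_def)
qed

text \<open>
  By \<open>correlation_0\<close> the determinant is a polynomial in \<open>s\<close> with value \<open>1\<close> at \<open>0\<close>, so it has only finitely
  many zeros.
\<close>

lemma eventually_det_correlation_nonzero:
  "eventually (\<lambda>s. det (correlation s) \<noteq> 0) (at_left x)"
proof -
  define P where "P i j =
    (\<Sum>k\<in>overlaps i j. monom (word_weight p (drop k (A i))) (length (A i) - k))" for i j
  define q where "q = det (\<chi> i j. P i j)"
  have q: "det (correlation s) = poly q s" for s
    unfolding q_def det_poly[symmetric] by (simp add: correlation_def P_def poly_sum poly_monom)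
  have "poly q 0 = 1" by (simp add: q[symmetric] correlation_0)
  then have "q \<noteq> 0" by auto
  then show ?thesis unfolding q by (rule eventually_poly_nonzero)
qed

lemma eventually_denominator_nonzero:
  "\<forall>\<^sub>F s in at_left 1.
     (\<Sum>j\<in>UNIV. det (correlation_repl j s)) + (1 - s) * det (correlation s) \<noteq> 0"
  using eventually_det_correlation_nonzero[of 1] eventually_at_left_1_unit
proof eventually_elim
  case (elim s)
  then show ?case using det_correlation_eq[of s] by auto
qed

lemma tendsto_det_ratio:
  "((\<lambda>s. ereal (det (correlation s) /
        ((\<Sum>j\<in>UNIV. det (correlation_repl j s)) + (1 - s) * det (correlation s))))
     \<longlongrightarrow> enn2ereal (\<Sum>n. ennreal (survival n))) (at_left 1)"
proof (rule Lim_transform_eventually)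
  show "((\<lambda>s. ereal (survival_gf s)) \<longlongrightarrow> enn2ereal (\<Sum>n. ennreal (survival n))) (at_left 1)"
    unfolding survival_gf_def
    by (intro tendsto_power_series_at_left_1 survival_nonneg summable_bounded_power survival_le_1) auto
  show "\<forall>\<^sub>F s in at_left 1. ereal (survival_gf s) = ereal (det (correlation s) /
      ((\<Sum>j\<in>UNIV. det (correlation_repl j s)) + (1 - s) * det (correlation s)))"
    using eventually_denominator_nonzero eventually_at_left_1_unit
  proof eventually_elim
    case (elim s)
    then show ?case using det_correlation_eq[of s] by (simp add: eq_divide_eq)
  qed
qed

lemma isCont_det_ratio:
  assumes "(\<Sum>j\<in>UNIV. det (correlation_repl j 1)) \<noteq> 0"
  shows "isCont (\<lambda>s. det (correlation s) /
        ((\<Sum>j\<in>UNIV. det (correlation_repl j s)) + (1 - s) * det (correlation s))) 1"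
proof -
  have entry: "isCont (\<lambda>s. correlation s $ i $ j) 1" for i j
    by (simp add: correlation_def)
  have entry': "isCont (\<lambda>s. correlation_repl k s $ i $ j) 1" for i j k
    using entry by (cases "j = k") (simp_all add: correlation_repl_def pattern_weights_def)
  show ?thesis
    using assms unfolding det_def
    by (intro continuous_intros entry entry') simp
qed

lemma survival_total_eq_det_ratio:
  assumes "(\<Sum>j\<in>UNIV. det (correlation_repl j 1)) \<noteq> 0"
  shows "enn2ereal (\<Sum>n. ennreal (survival n)) =
    ereal (det (correlation 1) / (\<Sum>j\<in>UNIV. det (correlation_repl j 1)))"
proof (rule tendsto_unique[OF _ tendsto_det_ratio])
  show "((\<lambda>s. ereal (det (correlation s) /
        ((\<Sum>j\<in>UNIV. det (correlation_repl j s)) + (1 - s) * det (correlation s))))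
     \<longlongrightarrow> ereal (det (correlation 1) / (\<Sum>j\<in>UNIV. det (correlation_repl j 1)))) (at_left 1)"
    using isCont_det_ratio[OF assms, THEN isContD, THEN filterlim_at_split[THEN iffD1]]
    by (simp add: tendsto_ereal)
qed simp

end

section \<open>The waiting time in terms of the initial words\<close>

definition initial_word :: "(nat \<Rightarrow> 'w \<Rightarrow> 'a) \<Rightarrow> nat \<Rightarrow> 'w \<Rightarrow> 'a list" where
  "initial_word \<xi> n \<omega> = map (\<lambda>k. \<xi> k \<omega>) [1..<n + 1]"

lemma length_initial_word [simp]: "length (initial_word \<xi> n \<omega>) = n"
  by (simp add: initial_word_def)

lemma nth_initial_word: "k < n \<Longrightarrow> initial_word \<xi> n \<omega> ! k = \<xi> (Suc k) \<omega>"
  by (simp add: initial_word_def del: upt_Suc)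

lemma take_initial_word: "m \<le> n \<Longrightarrow> take m (initial_word \<xi> n \<omega>) = initial_word \<xi> m \<omega>"
  by (simp add: initial_word_def take_map take_upt del: upt_Suc)

lemma occurs_at_iff_suffix: "occurs_at \<xi> B \<omega> n \<longleftrightarrow> suffix B (initial_word \<xi> n \<omega>)"
proof
  assume "occurs_at \<xi> B \<omega> n"
  then have "length B \<le> n" "B = drop (n - length B) (initial_word \<xi> n \<omega>)"
    by (auto simp: occurs_at_def initial_word_def drop_map drop_upt simp del: upt_Suc)
  then show "suffix B (initial_word \<xi> n \<omega>)" by (metis suffix_drop)
next
  assume suf: "suffix B (initial_word \<xi> n \<omega>)"
  then have len: "length B \<le> n" using suffix_length_le by fastforce
  have "B = drop (n - length B) (initial_word \<xi> n \<omega>)"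
    using suf by (metis suffix_take append_eq_conv_conj length_initial_word length_take min.absorb2 diff_le_self)
  with len show "occurs_at \<xi> B \<omega> n"
    by (simp add: occurs_at_def initial_word_def drop_map drop_upt del: upt_Suc)
qed

lemma sublist_initial_word_iff:
  "sublist B (initial_word \<xi> n \<omega>) \<longleftrightarrow> (\<exists>m\<le>n. occurs_at \<xi> B \<omega> m)"
proof
  assume "sublist B (initial_word \<xi> n \<omega>)"
  then obtain u where u: "prefix u (initial_word \<xi> n \<omega>)" "suffix B u"
    by (auto simp: sublist_altdef)
  have "length u \<le> n" using prefix_length_le[OF u(1)] by simp
  moreover from this u have "u = initial_word \<xi> (length u) \<omega>"
    by (metis append_eq_conv_conj prefix_def take_initial_word)
  ultimately show "\<exists>m\<le>n. occurs_at \<xi> B \<omega> m"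
    using u(2) unfolding occurs_at_iff_suffix by metis
next
  assume "\<exists>m\<le>n. occurs_at \<xi> B \<omega> m"
  then obtain m where m: "m \<le> n" "suffix B (initial_word \<xi> m \<omega>)"
    by (auto simp: occurs_at_iff_suffix)
  then show "sublist B (initial_word \<xi> n \<omega>)"
    unfolding sublist_altdef by (metis take_initial_word take_is_prefix)
qed

lemma pattern_time_le_iff:
  "pattern_time \<xi> B \<omega> \<le> enat n \<longleftrightarrow> (\<exists>m\<le>n. occurs_at \<xi> B \<omega> m)"
proof
  assume le: "pattern_time \<xi> B \<omega> \<le> enat n"
  let ?S = "enat ` {m. occurs_at \<xi> B \<omega> m}"
  have "?S \<noteq> {}"
  proof
    assume "?S = {}"
    then have "pattern_time \<xi> B \<omega> = \<infinity>"
      by (simp only: pattern_time_def Inf_empty top_enat_def)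
    with le show False by simp
  qed
  then obtain t where "t \<in> ?S" by (meson ex_in_conv)
  then have "pattern_time \<xi> B \<omega> \<in> ?S"
    unfolding pattern_time_def by (rule wellorder_InfI)
  then obtain m where m: "pattern_time \<xi> B \<omega> = enat m" "occurs_at \<xi> B \<omega> m" by (elim imageE) simp
  with le have "m \<le> n" by simp
  with m show "\<exists>m\<le>n. occurs_at \<xi> B \<omega> m" by blast
next
  assume "\<exists>m\<le>n. occurs_at \<xi> B \<omega> m"
  then obtain m where m: "m \<le> n" "occurs_at \<xi> B \<omega> m" by blast
  then have "pattern_time \<xi> B \<omega> \<le> enat m"
    unfolding pattern_time_def by (intro INF_lower) simp
  also have "enat m \<le> enat n" using m by simp
  finally show "pattern_time \<xi> B \<omega> \<le> enat n" .
qed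

lemma waiting_time_greater_iff:
  "enat n < waiting_time \<xi> A \<omega> \<longleftrightarrow> (\<forall>i. \<not> sublist (A i) (initial_word \<xi> n \<omega>))"
  by (simp add: waiting_time_def sublist_initial_word_iff pattern_time_le_iff[symmetric] not_le)

section \<open>The law of the initial words of an i.i.d. sequence\<close>

definition letter_prob :: "'w measure \<Rightarrow> (nat \<Rightarrow> 'w \<Rightarrow> 'a) \<Rightarrow> 'a \<Rightarrow> real" where
  "letter_prob M \<xi> a = measure M {\<omega> \<in> space M. \<xi> 1 \<omega> = a}"

lemma word_prob_eq_weight: "word_prob M \<xi> w = word_weight (letter_prob M \<xi>) w"
  by (simp add: word_prob_def word_weight_def letter_prob_def prod.list_conv_set_nth atLeast0LessThan)

locale iid_letter_sequence = prob_space M for M :: "'w measure" +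
  fixes \<xi> :: "nat \<Rightarrow> 'w \<Rightarrow> 'a::finite"
  assumes indep: "indep_vars (\<lambda>_. count_space UNIV) \<xi> {1..}"
    and same_distr: "n \<ge> 1 \<Longrightarrow> distr M (count_space UNIV) (\<xi> n) = distr M (count_space UNIV) (\<xi> 1)"
begin

lemma measurable_letter: "n \<ge> 1 \<Longrightarrow> \<xi> n \<in> measurable M (count_space UNIV)"
  using indep by (auto simp: indep_vars_def2)

lemma prob_letter:
  assumes n: "n \<ge> 1"
  shows "prob {\<omega> \<in> space M. \<xi> n \<omega> = a} = letter_prob M \<xi> a"
proof -
  have *: "prob {\<omega> \<in> space M. \<xi> n \<omega> = a} = measure (distr M (count_space UNIV) (\<xi> n)) {a}"
    if "n \<ge> 1" for n
    using measurable_letter[OF that] by (subst measure_distr) (auto intro!: arg_cong[where f = prob])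
  show ?thesis
    unfolding letter_prob_def *[OF n] *[OF order_refl] same_distr[OF n] ..
qed

lemma sum_letter_prob: "(\<Sum>a\<in>UNIV. letter_prob M \<xi> a) = 1"
proof -
  have "(\<Sum>a\<in>UNIV. letter_prob M \<xi> a) = prob (\<Union>a. {\<omega> \<in> space M. \<xi> 1 \<omega> = a})"
    unfolding letter_prob_def
    using measurable_letter[of 1]
    by (intro finite_measure_finite_Union[symmetric]) (auto simp: disjoint_family_on_def)
  also have "(\<Union>a. {\<omega> \<in> space M. \<xi> 1 \<omega> = a}) = space M" by auto
  finally show ?thesis by (simp add: prob_space)
qed

lemma initial_word_eq_event:
  assumes "length w = n"
  shows "{\<omega> \<in> space M. initial_word \<xi> n \<omega> = w} =
    {\<omega> \<in> space M. \<forall>k\<in>{1..n}. \<xi> k \<omega> = w ! (k - 1)}"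
proof -
  have "initial_word \<xi> n \<omega> = w \<longleftrightarrow> (\<forall>k\<in>{1..n}. \<xi> k \<omega> = w ! (k - 1))" for \<omega>
  proof
    assume "initial_word \<xi> n \<omega> = w"
    then show "\<forall>k\<in>{1..n}. \<xi> k \<omega> = w ! (k - 1)"
      using nth_initial_word[of _ n \<xi> \<omega>] by (auto simp: Suc_le_eq)
  next
    assume "\<forall>k\<in>{1..n}. \<xi> k \<omega> = w ! (k - 1)"
    then show "initial_word \<xi> n \<omega> = w"
      using assms by (intro nth_equalityI) (auto simp: nth_initial_word)
  qed
  then show ?thesis by simp
qed

lemma sets_initial_word_eq:
  assumes "length w = n"
  shows "{\<omega> \<in> space M. initial_word \<xi> n \<omega> = w} \<in> sets M"
  unfolding initial_word_eq_event[OF assms]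
proof (rule sets.sets_Collect_finite_All)
  fix k assume "k \<in> {1..n}"
  then have [measurable]: "\<xi> k \<in> measurable M (count_space UNIV)"
    by (intro measurable_letter) simp
  show "{\<omega> \<in> space M. \<xi> k \<omega> = w ! (k - 1)} \<in> sets M" by measurable
qed simp

lemma prob_initial_word_eq:
  assumes len: "length w = n"
  shows "prob {\<omega> \<in> space M. initial_word \<xi> n \<omega> = w} = word_weight (letter_prob M \<xi>) w"
proof (cases "n = 0")
  case True
  then show ?thesis using len by (simp add: initial_word_def word_weight_def prob_space)
next
  case False
  have "{\<omega> \<in> space M. initial_word \<xi> n \<omega> = w} = (\<Inter>k\<in>{1..n}. \<xi> k -` {w ! (k - 1)} \<inter> space M)"
    unfolding initial_word_eq_event[OF len] using False by auto
  also have "prob \<dots> = (\<Prod>k\<in>{1..n}. prob (\<xi> k -` {w ! (k - 1)} \<inter> space M))"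
    using False by (intro indep_varsD[OF indep]) auto
  also have "\<dots> = (\<Prod>k\<in>{1..n}. letter_prob M \<xi> (w ! (k - 1)))"
  proof (rule prod.cong[OF refl])
    fix k assume "k \<in> {1..n}"
    moreover have "\<xi> k -` {w ! (k - 1)} \<inter> space M = {\<omega> \<in> space M. \<xi> k \<omega> = w ! (k - 1)}" by auto
    ultimately show "prob (\<xi> k -` {w ! (k - 1)} \<inter> space M) = letter_prob M \<xi> (w ! (k - 1))"
      by (simp add: prob_letter)
  qed
  also have "\<dots> = (\<Prod>k<n. letter_prob M \<xi> (w ! k))"
    by (rule prod.reindex_bij_witness[of _ Suc "\<lambda>k. k - 1"]) auto
  also have "\<dots> = word_weight (letter_prob M \<xi>) w"
    using len by (simp add: word_weight_def prod.list_conv_set_nth atLeast0LessThan)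
  finally show ?thesis .
qed

lemma initial_word_in:
  assumes len: "\<And>w. w \<in> W \<Longrightarrow> length w = n"
  shows "{\<omega> \<in> space M. initial_word \<xi> n \<omega> \<in> W} \<in> sets M"
    and "prob {\<omega> \<in> space M. initial_word \<xi> n \<omega> \<in> W} = (\<Sum>w\<in>W. word_weight (letter_prob M \<xi>) w)"
proof -
  have fin: "finite W"
    by (rule finite_subset[OF _ finite_lists_length_eq[of UNIV n]]) (auto simp: len)
  have eq: "{\<omega> \<in> space M. initial_word \<xi> n \<omega> \<in> W} =
      (\<Union>w\<in>W. {\<omega> \<in> space M. initial_word \<xi> n \<omega> = w})" by auto
  show "{\<omega> \<in> space M. initial_word \<xi> n \<omega> \<in> W} \<in> sets M"
    unfolding eq by (intro sets.finite_UN fin sets_initial_word_eq len)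
  have "prob {\<omega> \<in> space M. initial_word \<xi> n \<omega> \<in> W} =
      (\<Sum>w\<in>W. prob {\<omega> \<in> space M. initial_word \<xi> n \<omega> = w})"
    unfolding eq
    by (intro finite_measure_finite_Union fin)
      (auto simp: disjoint_family_on_def intro!: sets_initial_word_eq len)
  then show "prob {\<omega> \<in> space M. initial_word \<xi> n \<omega> \<in> W} = (\<Sum>w\<in>W. word_weight (letter_prob M \<xi>) w)"
    by (simp add: prob_initial_word_eq len)
qed

text \<open>
  The expectation of a random variable with values in the extended naturals is the sum of its tail
  probabilities, and \<open>waiting_time\<close> exceeds \<open>n\<close> exactly when the initial word of length \<open>n\<close> avoids
  the patterns.
\<close>

lemma expected_waiting_time_eq:
  fixes A :: "'m::finite \<Rightarrow> 'a list"
  assumes "weighted_patterns (letter_prob M \<xi>) A"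
  shows "expected_waiting_time M \<xi> A =
    (\<Sum>n. ennreal (weighted_patterns.survival (letter_prob M \<xi>) A n))"
proof -
  interpret weighted_patterns "letter_prob M \<xi>" A by (rule assms)
  have event: "{\<omega> \<in> space M. enat n < waiting_time \<xi> A \<omega>} =
      {\<omega> \<in> space M. initial_word \<xi> n \<omega> \<in> avoiding n}" for n
    by (auto simp: waiting_time_greater_iff avoiding_def)
  have sets: "{\<omega> \<in> space M. enat n < waiting_time \<xi> A \<omega>} \<in> sets M" for n
    unfolding event by (rule initial_word_in) (simp add: avoiding_def)
  have "(\<lambda>\<omega>. waiting_time \<xi> A \<omega>) \<in> measurable M (count_space UNIV)"
    unfolding measurable_count_space_eq2_countable
  proof (intro conjI ballI)
    fix t :: enat
    \<comment> \<open>A value in the extended naturals is determined by the finite numbers below it, so measurability reduces to that of the tail events.\<close>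
    have "(\<lambda>\<omega>. waiting_time \<xi> A \<omega>) -` {t} \<inter> space M =
        {\<omega> \<in> space M. \<forall>n. enat n < t \<longleftrightarrow> enat n < waiting_time \<xi> A \<omega>}"
    proof -
      have "u = t" if "\<forall>n. enat n < t \<longleftrightarrow> enat n < u" for u
      proof (rule antisym; rule leI; rule notI)
        assume "t < u"
        then obtain n where "t = enat n" by (cases t) auto
        with that \<open>t < u\<close> show False by blast
      next
        assume "u < t"
        then obtain n where "u = enat n" by (cases u) auto
        with that \<open>u < t\<close> show False by blast
      qed
      then show ?thesis by auto
    qed
    also have "\<dots> \<in> sets M"
    proof (rule sets.sets_Collect_countable_All)
      fix n show "{\<omega> \<in> space M. enat n < t \<longleftrightarrow> enat n < waiting_time \<xi> A \<omega>} \<in> sets M"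
        using sets[of n] sets.sets_Collect_neg[OF sets[of n]] by (cases "enat n < t") auto
    qed
    finally show "(\<lambda>\<omega>. waiting_time \<xi> A \<omega>) -` {t} \<inter> space M \<in> sets M" .
  qed simp
  then have "expected_waiting_time M \<xi> A = (\<Sum>n. emeasure M {\<omega> \<in> space M. enat n < waiting_time \<xi> A \<omega>})"
    unfolding expected_waiting_time_def by (rule nn_integral_enat_function)
  also have "\<dots> = (\<Sum>n. ennreal (survival n))"
    unfolding event survival_def emeasure_eq_measure
    by (subst initial_word_in(2)) (auto simp: avoiding_def)
  finally show ?thesis .
qed

end

section \<open>The expected waiting time\<close>

theorem corollary2p5:
  fixes M :: "'w measure"
    and \<xi> :: "nat \<Rightarrow> 'w \<Rightarrow> 'a::finite"
    and A :: "'m::finite \<Rightarrow> 'a list"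
  assumes "iid_letters M \<xi>"
    and "\<And>i. A i \<noteq> []"
    and "reduced_patterns A"
  shows "(\<forall>\<^sub>F s in at_left 1.
            (\<Sum>j\<in>UNIV. det (corr_matrix_repl M \<xi> A j s)) + (1 - s) * det (corr_matrix M \<xi> A s) \<noteq> 0)
       \<and> ((\<lambda>s. ereal (det (corr_matrix M \<xi> A s) /
             ((\<Sum>j\<in>UNIV. det (corr_matrix_repl M \<xi> A j s)) + (1 - s) * det (corr_matrix M \<xi> A s))))
          \<longlongrightarrow> enn2ereal (expected_waiting_time M \<xi> A)) (at_left 1)
       \<and> ((\<Sum>j\<in>UNIV. det (corr_matrix_repl M \<xi> A j 1)) \<noteq> 0 \<longrightarrow>
          enn2ereal (expected_waiting_time M \<xi> A) =
            ereal (det (corr_matrix M \<xi> A 1) / (\<Sum>j\<in>UNIV. det (corr_matrix_repl M \<xi> A j 1))))"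
proof -
  interpret iid_letter_sequence M \<xi>
    using assms(1) unfolding iid_letters_def iid_letter_sequence_def iid_letter_sequence_axioms_def
    by blast
  interpret weighted_patterns "letter_prob M \<xi>" A
  proof
    show "\<not> sublist (A i) (A j)" if "i \<noteq> j" for i j
      using assms(3) that by (simp add: reduced_patterns_def)
  qed (simp_all add: assms(2) sum_letter_prob, simp add: letter_prob_def)
  have corr: "corr_poly M \<xi> (A i) (A j) s = correlation s $ i $ j" for i j s
  proof -
    have "corr_poly M \<xi> (A i) (A j) s = (\<Sum>k = 1..min (length (A i)) (length (A j)).
        if take k (A i) = last_letters k (A j)
        then word_weight (letter_prob M \<xi>) (drop k (A i)) * s ^ (length (A i) - k) else 0)"
      unfolding corr_poly_def
    proof (intro sum.cong refl)
      fix k assume "k \<in> {1..min (length (A i)) (length (A j))}"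
      then have "last_letters (length (A i) - k) (A i) = drop k (A i)"
        by (simp add: last_letters_def)
      then show "(if take k (A i) = last_letters k (A j) then 1 else 0) *
          word_prob M \<xi> (last_letters (length (A i) - k) (A i)) * s ^ (length (A i) - k) =
          (if take k (A i) = last_letters k (A j)
           then word_weight (letter_prob M \<xi>) (drop k (A i)) * s ^ (length (A i) - k) else 0)"
        by (simp add: word_prob_eq_weight)
    qed
    also have "\<dots> = correlation s $ i $ j"
      unfolding correlation_def overlaps_def vec_lambda_beta by (subst sum.inter_filter) simp_all
    finally show ?thesis .
  qed
  have matrix: "corr_matrix M \<xi> A = correlation"
    by (rule ext) (simp add: corr_matrix_def corr vec_eq_iff)
  have repl: "corr_matrix_repl M \<xi> A = correlation_repl"
    by (intro ext)
      (simp add: vec_eq_iff corr_matrix_repl_def correlation_repl_def matrix pattern_weights_def word_prob_eq_weight)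
  have time: "expected_waiting_time M \<xi> A = (\<Sum>n. ennreal (survival n))"
    by (rule expected_waiting_time_eq) unfold_locales
  show ?thesis
    unfolding matrix repl time
    using eventually_denominator_nonzero tendsto_det_ratio survival_total_eq_det_ratio by blast
qed

end
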